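(* Let $f,g\in\mathbb{Q}[x]$ be polynomials with rational coefficients and let $C$ be the affine curve given by the rational parametrization $t\mapsto \left(f(t),g\left(\frac{1}{t}\right)\right)$, where $t$ ranges over the nonzero real numbers. Then there exists an additive function $h:\mathbb{R}\rightarrow\mathbb{R}$ which is not identically zero and which satisfies $h(x)h(y)=0$ whenever $(x,y)\in C$.
   Context: A function $h:\mathbb{R}\to\mathbb{R}$ is additive if $h(x+y)=h(x)+h(y)$ for all $x,y\in\mathbb{R}$. Here $(x,y)\in C$ means that $(x,y)=\left(f(t),g\left(\frac1t\right)\right)$ for some real $t\neq 0$. *)

theory Defs
  imports Complex_Main "HOL-Computational_Algebra.Polynomial"
begin

definition real_eval :: "rat poly \<Rightarrow> real \<Rightarrow> real" where
  "real_eval p t = poly (map_poly of_rat p) t"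

definition param_curve :: "rat poly \<Rightarrow> rat poly \<Rightarrow> (real \<times> real) set" where
  "param_curve f g = {(real_eval f t, real_eval g (1 / t)) | t. t \<noteq> 0}"

end

theory Submission
  imports Defs "HOL-Analysis.Continuum_Not_Denumerable"
begin

text \<open>
  The function \<open>h\<close> comes from a valuation ring. Suppose that \<open>A\<close> is a proper subring of the reals
  that contains \<open>\<rat>\<close> and that contains \<open>t\<close> or \<open>1 / t\<close> for every \<open>t \<noteq> 0\<close>. Since \<open>f\<close> and \<open>g\<close> have
  rational coefficients, \<open>A\<close> contains \<open>f t\<close> in the first case and \<open>g (1 / t)\<close> in the second. So
  every point of the curve has a coordinate in \<open>A\<close>, and it suffices that \<open>h\<close> is additive, is not
  zero, and vanishes on \<open>A\<close>. As \<open>A\<close> is a proper \<open>\<rat>\<close>-subspace, linear algebra over \<open>\<rat>\<close> gives such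
  an \<open>h\<close>.

  The ring \<open>A\<close> is found by the argument of Chevalley for the extension of valuations. Choose a
  transcendental real \<open>s\<close>, so that \<open>s\<close> is not a unit of \<open>\<rat>[s]\<close>, and let \<open>A\<close> be maximal among the
  subrings in which \<open>s\<close> stays a non-unit. If neither \<open>t\<close> nor \<open>1 / t\<close> were in \<open>A\<close>, then by
  maximality \<open>1 / s\<close> would be a polynomial in \<open>t\<close> and also a polynomial in \<open>1 / t\<close> over \<open>A\<close>.
  By \<open>power_span_reduce\<close> each of the two expressions can be used to lower the degree of the other
  one, and so \<open>1 / s\<close> would finally be in \<open>A\<close>.
\<close>

section \<open>Polynomial expressions over a subring\<close>

text \<open>Closure under negation is implied, because \<open>- 1\<close> is rational.\<close>

definition rat_subring :: "'a::field_char_0 set \<Rightarrow> bool" where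
  "rat_subring A \<longleftrightarrow> \<rat> \<subseteq> A \<and> (\<forall>x\<in>A. \<forall>y\<in>A. x + y \<in> A \<and> x * y \<in> A)"

lemma
  assumes "rat_subring A"
  shows rat_subring_Rats: "q \<in> \<rat> \<Longrightarrow> q \<in> A"
    and rat_subring_0: "0 \<in> A"
    and rat_subring_1: "1 \<in> A"
    and rat_subring_add: "x \<in> A \<Longrightarrow> y \<in> A \<Longrightarrow> x + y \<in> A"
    and rat_subring_mult: "x \<in> A \<Longrightarrow> y \<in> A \<Longrightarrow> x * y \<in> A"
    and rat_subring_diff: "x \<in> A \<Longrightarrow> y \<in> A \<Longrightarrow> x - y \<in> A"
proof -
  show R: "q \<in> A" if "q \<in> \<rat>" for q
    using assms that by (auto simp: rat_subring_def)
  show "0 \<in> A" "1 \<in> A"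
    using R by auto
  show add: "x + y \<in> A" and mult: "x * y \<in> A" if "x \<in> A" "y \<in> A" for x y
    using assms that by (auto simp: rat_subring_def)
  show "x - y \<in> A" if "x \<in> A" "y \<in> A" for x y
    using add[OF that(1) mult[OF R[of "- 1"] that(2)]] by simp
qed

lemma rat_subring_power: "rat_subring A \<Longrightarrow> x \<in> A \<Longrightarrow> x ^ n \<in> A"
  by (induction n) (auto intro: rat_subring_1 rat_subring_mult)

text \<open>
  The bound \<open>n\<close> on the degree of the polynomials is part of the notion because the valuation
  property is proved by descent on it.
\<close>

definition power_span :: "'a::field_char_0 set \<Rightarrow> 'a \<Rightarrow> nat \<Rightarrow> 'a set" where
  "power_span A t n = {\<Sum>i<n. a i * t ^ i | a. \<forall>i. a i \<in> A}"

lemma power_spanI: "(\<And>i. a i \<in> A) \<Longrightarrow> x = (\<Sum>i<n. a i * t ^ i) \<Longrightarrow> x \<in> power_span A t n"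
  by (auto simp: power_span_def)

lemma power_spanE:
  assumes "x \<in> power_span A t n"
  obtains a where "\<And>i. a i \<in> A" "x = (\<Sum>i<n. a i * t ^ i)"
  using assms by (auto simp: power_span_def)

lemma power_span_0: "x \<in> power_span A t 0 \<Longrightarrow> x = 0"
  by (auto elim: power_spanE)

lemma power_span_add:
  assumes "rat_subring A" "x \<in> power_span A t n" "y \<in> power_span A t n"
  shows "x + y \<in> power_span A t n"
proof -
  obtain a where "\<And>i. a i \<in> A" "x = (\<Sum>i<n. a i * t ^ i)" using assms by (blast elim: power_spanE)
  moreover obtain b where "\<And>i. b i \<in> A" "y = (\<Sum>i<n. b i * t ^ i)"
    using assms by (blast elim: power_spanE)
  ultimately show ?thesis
    by (intro power_spanI[where a="\<lambda>i. a i + b i"])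
      (auto intro: rat_subring_add[OF assms(1)] simp: sum.distrib algebra_simps)
qed

lemma power_span_scale:
  assumes "rat_subring A" "c \<in> A" "x \<in> power_span A t n"
  shows "c * x \<in> power_span A t n"
proof -
  obtain a where "\<And>i. a i \<in> A" "x = (\<Sum>i<n. a i * t ^ i)" using assms by (blast elim: power_spanE)
  then show ?thesis
    by (intro power_spanI[where a="\<lambda>i. c * a i"])
      (auto intro: rat_subring_mult[OF assms(1)] assms(2) simp: sum_distrib_left algebra_simps)
qed

lemma power_span_mult_power:
  assumes "rat_subring A" "x \<in> power_span A t n"
  shows "t ^ k * x \<in> power_span A t (k + n)"
proof -
  obtain a where a: "\<And>i. a i \<in> A" "x = (\<Sum>i<n. a i * t ^ i)"
    using assms by (blast elim: power_spanE)
  let ?b = "\<lambda>i. if i < k then 0 else a (i - k)"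
  have "t ^ k * x = (\<Sum>i<k+n. ?b i * t ^ i)"
    unfolding a(2) by (induction n) (auto simp: power_add algebra_simps)
  then show ?thesis
    by (intro power_spanI[where a="?b"]) (auto intro: a rat_subring_0[OF assms(1)])
qed

lemma power_span_mono:
  assumes "rat_subring A" "x \<in> power_span A t n" "n \<le> m"
  shows "x \<in> power_span A t m"
proof -
  obtain a where a: "\<And>i. a i \<in> A" "x = (\<Sum>i<n. a i * t ^ i)"
    using assms by (blast elim: power_spanE)
  have "(\<Sum>i<m. (if i < n then a i else 0) * t ^ i) = x"
    unfolding a(2) using assms(3) by (intro sum.mono_neutral_cong_right) auto
  then show ?thesis
    by (intro power_spanI[where a="\<lambda>i. if i < n then a i else 0"])
      (auto intro: a rat_subring_0[OF assms(1)])
qed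

lemma power_span_mult:
  assumes A: "rat_subring A" and "x \<in> power_span A t n" "y \<in> power_span A t m"
  shows "x * y \<in> power_span A t (n + m)"
proof -
  obtain b where b: "\<And>i. b i \<in> A" "y = (\<Sum>i<m. b i * t ^ i)"
    using assms by (blast elim: power_spanE)
  have "x * (\<Sum>i<k. b i * t ^ i) \<in> power_span A t (n + k)" for k
  proof (induction k)
    case 0
    show ?case
      by (auto intro!: power_spanI[where a="\<lambda>_. 0"] rat_subring_0[OF A])
  next
    case (Suc k)
    have "b k * (t ^ k * x) \<in> power_span A t (k + n)"
      by (intro power_span_scale power_span_mult_power assms b)
    with Suc have "x * (\<Sum>i<k. b i * t ^ i) + b k * (t ^ k * x) \<in> power_span A t (n + k)"
      by (intro power_span_add A) (auto simp: add.commute)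
    then show ?case
      by (auto intro: power_span_mono[OF A] simp: algebra_simps)
  qed
  then show ?thesis using b by simp
qed

lemma power_span_subset:
  assumes A: "rat_subring A" and "t \<in> A"
  shows "power_span A t n \<subseteq> A"
proof
  fix x assume "x \<in> power_span A t n"
  then obtain a where a: "\<And>i. a i \<in> A" "x = (\<Sum>i<n. a i * t ^ i)"
    by (blast elim: power_spanE)
  have "(\<Sum>i<k. a i * t ^ i) \<in> A" for k
    by (induction k)
      (auto intro: rat_subring_0[OF A] rat_subring_add[OF A] rat_subring_mult[OF A]
        rat_subring_power[OF A] a assms(2))
  with a show "x \<in> A" by simp
qed

lemma power_span_reflect:
  assumes "x \<in> power_span A (1 / t) (Suc n)" "t \<noteq> 0"
  shows "t ^ n * x \<in> power_span A t (Suc n)"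
proof -
  obtain a where a: "\<And>i. a i \<in> A" "x = (\<Sum>i<Suc n. a i * (1 / t) ^ i)"
    using assms by (blast elim: power_spanE)
  have "t ^ n * x = (\<Sum>i<Suc n. a i * t ^ (n - i))"
    unfolding a(2) sum_distrib_left
  proof (intro sum.cong refl)
    fix i assume "i \<in> {..<Suc n}"
    then have "t ^ n = t ^ (n - i) * t ^ i"
      by (simp flip: power_add)
    then show "t ^ n * (a i * (1 / t) ^ i) = a i * t ^ (n - i)"
      using assms(2) by (simp add: power_divide)
  qed
  also have "\<dots> = (\<Sum>i<Suc n. a (n - i) * t ^ i)"
    by (subst sum.nat_diff_reindex[symmetric]) (auto intro!: sum.cong)
  finally show ?thesis
    by (intro power_spanI[where a="\<lambda>i. a (n - i)"] a)
qed

lemma power_span_split_first: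
  assumes "x \<in> power_span A t (Suc n)"
  obtains b y where "b \<in> A" "y \<in> power_span A t n" "x = b + t * y"
proof -
  obtain a where a: "\<And>i. a i \<in> A" "x = (\<Sum>i<Suc n. a i * t ^ i)"
    using assms by (blast elim: power_spanE)
  show ?thesis
  proof (rule that[of "a 0" "\<Sum>i<n. a (Suc i) * t ^ i"])
    show "x = a 0 + t * (\<Sum>i<n. a (Suc i) * t ^ i)"
      unfolding a(2) sum.lessThan_Suc_shift by (simp add: sum_distrib_left algebra_simps)
  qed (auto intro: a power_spanI)
qed

lemma power_span_split_last:
  assumes "x \<in> power_span A t (Suc n)"
  obtains a y where "a \<in> A" "y \<in> power_span A t n" "x = y + a * t ^ n"
  using assms by (elim power_spanE) (auto intro: power_spanI)

definition adjoin :: "'a::field_char_0 set \<Rightarrow> 'a \<Rightarrow> 'a set" where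
  "adjoin A t = (\<Union>n. power_span A t n)"

lemma adjoin_superset:
  assumes "rat_subring A"
  shows "A \<subseteq> adjoin A t" "t \<in> adjoin A t"
proof -
  have "a \<in> power_span A t 1" if "a \<in> A" for a
    using that by (intro power_spanI[where a="\<lambda>_. a"]) auto
  then show A: "A \<subseteq> adjoin A t"
    by (auto simp: adjoin_def)
  have "1 \<in> power_span A t 1"
    by (intro power_spanI[where a="\<lambda>_. 1"]) (auto intro: rat_subring_1[OF assms])
  from power_span_mult_power[OF assms this, of 1] show "t \<in> adjoin A t"
    by (auto simp: adjoin_def)
qed

lemma rat_subring_adjoin:
  assumes A: "rat_subring A"
  shows "rat_subring (adjoin A t)"
  unfolding rat_subring_def
proof (intro conjI ballI)
  show "\<rat> \<subseteq> adjoin A t"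
    using adjoin_superset(1)[OF A] rat_subring_Rats[OF A] by blast
  fix x y assume "x \<in> adjoin A t" "y \<in> adjoin A t"
  then obtain n m where nm: "x \<in> power_span A t n" "y \<in> power_span A t m"
    by (auto simp: adjoin_def)
  then have "x + y \<in> power_span A t (n + m)"
    by (intro power_span_add[OF A] power_span_mono[OF A nm(1)] power_span_mono[OF A nm(2)]) auto
  then show "x + y \<in> adjoin A t" by (auto simp: adjoin_def)
  show "x * y \<in> adjoin A t"
    using power_span_mult[OF A nm] by (auto simp: adjoin_def)
qed

section \<open>Subrings maximal with a given non-unit\<close>

text \<open>The non-unit is \<open>s\<close>; membership of \<open>1 / s\<close> would make it a unit.\<close>

definition nonunit_subring :: "'a::field_char_0 \<Rightarrow> 'a set \<Rightarrow> bool" where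
  "nonunit_subring s A \<longleftrightarrow> rat_subring A \<and> s \<in> A \<and> 1 / s \<notin> A"

definition maximal_nonunit_subring :: "'a::field_char_0 \<Rightarrow> 'a set \<Rightarrow> bool" where
  "maximal_nonunit_subring s A \<longleftrightarrow>
     nonunit_subring s A \<and> (\<forall>B. nonunit_subring s B \<longrightarrow> A \<subseteq> B \<longrightarrow> B = A)"

lemma nonunit_subring_nonzero: "nonunit_subring s A \<Longrightarrow> s \<noteq> 0"
  by (auto simp: nonunit_subring_def rat_subring_0)

lemma maximal_nonunit_subringD:
  assumes "maximal_nonunit_subring s A" "t \<notin> A"
  shows "1 / s \<in> adjoin A t"
proof (rule ccontr)
  assume "1 / s \<notin> adjoin A t"
  then have "nonunit_subring s (adjoin A t)"
    using assms adjoin_superset[of A t] rat_subring_adjoin[of A t]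
    by (auto simp: maximal_nonunit_subring_def nonunit_subring_def)
  with assms adjoin_superset[of A t] show False
    by (metis maximal_nonunit_subring_def nonunit_subring_def)
qed

text \<open>
  Inverting \<open>u = 1 - s * b\<close> does not make \<open>s\<close> invertible, because all powers of \<open>u\<close> are still
  congruent to 1 modulo \<open>s\<close>: an equation \<open>1 / s = c / u ^ n\<close> would give \<open>1 \<in> s * A\<close>. Therefore a
  maximal \<open>A\<close> already contains \<open>1 / u\<close>.
\<close>

lemma maximal_nonunit_subring_unit:
  assumes max: "maximal_nonunit_subring s A" and b: "b \<in> A"
  shows "1 - s * b \<noteq> 0" "1 / (1 - s * b) \<in> A"
proof -
  let ?u = "1 - s * b"
  have A: "rat_subring A" and s: "s \<in> A" "1 / s \<notin> A" and "s \<noteq> 0"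
    using max nonunit_subring_nonzero
    by (auto simp: maximal_nonunit_subring_def nonunit_subring_def)
  have "?u \<in> A"
    by (intro rat_subring_diff rat_subring_mult rat_subring_1 A s b)
  show "?u \<noteq> 0"
  proof
    assume "?u = 0"
    then have "b = 1 / s"
      using \<open>s \<noteq> 0\<close> by (simp add: field_simps)
    with b s show False by simp
  qed
  show "1 / ?u \<in> A"
  proof (rule ccontr)
    assume "1 / ?u \<notin> A"
    then obtain n where "1 / s \<in> power_span A (1 / ?u) n"
      using maximal_nonunit_subringD[OF max] by (auto simp: adjoin_def)
    then have "1 / s \<in> power_span A (1 / ?u) (Suc n)"
      by (rule power_span_mono[OF A]) simp
    then have c: "?u ^ n * (1 / s) \<in> A"
      using power_span_reflect \<open>?u \<noteq> 0\<close> power_span_subset[OF A \<open>?u \<in> A\<close>] by blast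
    have "\<exists>d\<in>A. ?u ^ n = 1 - s * d" for n
    proof (induction n)
      case 0
      show ?case by (rule bexI[of _ 0]) (auto intro: rat_subring_0 A)
    next
      case (Suc n)
      then obtain d where "d \<in> A" "?u ^ n = 1 - s * d" by blast
      then have "?u ^ Suc n = 1 - s * (b + ?u * d)"
        by (simp only: power_Suc) (simp add: algebra_simps)
      moreover have "b + ?u * d \<in> A"
        by (intro rat_subring_add rat_subring_mult A b \<open>?u \<in> A\<close> \<open>d \<in> A\<close>)
      ultimately show ?case by blast
    qed
    then obtain d where "d \<in> A" "?u ^ n = 1 - s * d" by blast
    then have "1 / s = ?u ^ n * (1 / s) + d"
      using \<open>s \<noteq> 0\<close> by (simp add: field_simps)
    with c \<open>d \<in> A\<close> s(2) show False
      by (metis rat_subring_add[OF A])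
  qed
qed

text \<open>
  Write \<open>1 / s = b + y / t\<close>, where \<open>y\<close> has degree less than \<open>m\<close> in \<open>1 / t\<close>. Since \<open>1 - s * b\<close> is a
  unit, clearing denominators expresses \<open>t ^ m\<close>, and so also \<open>t ^ n\<close>, as \<open>s\<close> times an expression
  of lower degree in \<open>t\<close>. This replaces the leading term of the other expression for \<open>1 / s\<close>.
\<close>

lemma power_span_reduce:
  assumes max: "maximal_nonunit_subring s A" and "t \<noteq> 0" and "m \<le> n"
    and t: "1 / s \<in> power_span A t (Suc n)" and t': "1 / s \<in> power_span A (1 / t) (Suc m)"
  shows "1 / s \<in> power_span A t n"
proof -
  have A: "rat_subring A" and s: "s \<in> A" "1 / s \<notin> A" and "s \<noteq> 0"
    using max nonunit_subring_nonzero
    by (auto simp: maximal_nonunit_subring_def nonunit_subring_def)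
  obtain b y where b: "b \<in> A" and y: "y \<in> power_span A (1 / t) m" and sb: "1 / s = b + 1 / t * y"
    using power_span_split_first[OF t'] .
  \<comment> \<open>For \<open>m = 0\<close> the second expression is a constant of \<open>A\<close>, which \<open>1 / s\<close> is not.\<close>
  obtain k where k: "m = Suc k"
  proof (cases m)
    case 0
    with y power_span_0 have "y = 0" by blast
    with sb b s show ?thesis by simp
  qed
  let ?u = "1 - s * b"
  have u: "?u \<noteq> 0" "1 / ?u \<in> A"
    using maximal_nonunit_subring_unit[OF max b] by auto
  have "?u * t = s * y"
    using sb \<open>s \<noteq> 0\<close> \<open>t \<noteq> 0\<close> by (simp add: field_simps)
  then have "t = s * (1 / ?u * y)"
    using u by (simp add: field_simps)
  moreover have "t ^ n = t ^ (n - m) * (t ^ k * t)"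
    using \<open>m \<le> n\<close> by (simp add: k flip: power_add power_Suc power_Suc2)
  ultimately have tn: "t ^ n = s * (1 / ?u * (t ^ (n - m) * (t ^ k * y)))"
    by (metis mult.left_commute)
  have "t ^ k * y \<in> power_span A t (Suc k)"
    using power_span_reflect y k \<open>t \<noteq> 0\<close> by blast
  then have "t ^ (n - m) * (t ^ k * y) \<in> power_span A t n"
    using power_span_mult_power[OF A, of _ t "Suc k" "n - m"] k \<open>m \<le> n\<close> by simp
  then have low: "t ^ n \<in> power_span A t n"
    unfolding tn by (intro power_span_scale[OF A s(1)] power_span_scale[OF A u(2)])
  obtain a x where "a \<in> A" "x \<in> power_span A t n" "1 / s = x + a * t ^ n"
    using power_span_split_last[OF t] .
  then show ?thesis
    by (auto intro: power_span_add power_span_scale A low)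
qed

text \<open>
  Descent on the sum of the two degrees. The expression of higher degree is the one that can be
  shortened; the roles of \<open>t\<close> and \<open>1 / t\<close> are symmetric. It ends at an empty sum, while
  \<open>1 / s \<noteq> 0\<close>.
\<close>

lemma not_both_power_span:
  assumes max: "maximal_nonunit_subring s A"
    and "t \<noteq> 0" "1 / s \<in> power_span A t n" "1 / s \<in> power_span A (1 / t) m"
  shows False
  using assms(2-)
proof (induction "n + m" arbitrary: n m t rule: less_induct)
  case less
  have "1 / s \<noteq> 0"
    using max nonunit_subring_nonzero by (auto simp: maximal_nonunit_subring_def)
  with less.prems power_span_0 obtain n' m' where nm: "n = Suc n'" "m = Suc m'"
    by (metis not0_implies_Suc)
  show ?case
  proof (cases "m' \<le> n'")
    case True
    then have "1 / s \<in> power_span A t n'"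
      using power_span_reduce[OF max, of t m' n'] less.prems nm by blast
    with less nm show False by (metis add_less_mono1 lessI)
  next
    case False
    then have "1 / s \<in> power_span A (1 / t) m'"
      using power_span_reduce[OF max, of "1 / t" n' m'] less.prems nm by simp
    with less nm show False by (metis add_less_cancel_left lessI)
  qed
qed

lemma maximal_nonunit_subring_valuation:
  assumes "maximal_nonunit_subring s A" "t \<noteq> 0"
  shows "t \<in> A \<or> 1 / t \<in> A"
proof (rule ccontr)
  assume "\<not> ?thesis"
  then have "1 / s \<in> adjoin A t" "1 / s \<in> adjoin A (1 / t)"
    using maximal_nonunit_subringD[OF assms(1)] by blast+
  then show False
    using not_both_power_span[OF assms] by (auto simp: adjoin_def)
qed

lemma maximal_nonunit_subring_exists:
  assumes "nonunit_subring s A"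
  obtains M where "maximal_nonunit_subring s M"
proof -
  have "\<exists>M\<in>Collect (nonunit_subring s). \<forall>X\<in>Collect (nonunit_subring s). M \<subseteq> X \<longrightarrow> X = M"
  proof (rule subset_Zorn_nonempty)
    fix C assume C: "C \<noteq> {}" "subset.chain (Collect (nonunit_subring s)) C"
    have sub: "nonunit_subring s B" if "B \<in> C" for B
      using C(2) that by (auto simp: subset.chain_def)
    have "x + y \<in> \<Union>C \<and> x * y \<in> \<Union>C" if "x \<in> \<Union>C" "y \<in> \<Union>C" for x y
    proof -
      obtain X Y where XY: "X \<in> C" "Y \<in> C" "x \<in> X" "y \<in> Y"
        using \<open>x \<in> \<Union>C\<close> \<open>y \<in> \<Union>C\<close> by (elim UnionE)
      then have "X \<subseteq> Y \<or> Y \<subseteq> X"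
        using C(2) unfolding subset_chain_def by metis
      with XY obtain B where B: "B \<in> C" "x \<in> B" "y \<in> B"
        by (metis subsetD)
      then have "x + y \<in> B \<and> x * y \<in> B"
        using sub[OF \<open>B \<in> C\<close>] by (simp add: nonunit_subring_def rat_subring_def)
      with \<open>B \<in> C\<close> show ?thesis by (metis UnionI)
    qed
    moreover have "\<rat> \<subseteq> \<Union>C" "s \<in> \<Union>C"
      using C(1) sub unfolding nonunit_subring_def rat_subring_def
      by (metis all_not_in_conv Sup_upper2 UnionI)+
    moreover have "1 / s \<notin> \<Union>C"
      using sub unfolding nonunit_subring_def by (metis UnionE)
    ultimately show "\<Union>C \<in> Collect (nonunit_subring s)"
      unfolding nonunit_subring_def rat_subring_def mem_Collect_eq by metis
  qed (use assms in auto)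
  then show ?thesis
    using that by (auto simp: maximal_nonunit_subring_def)
qed

section \<open>A transcendental number\<close>

lemma countable_algebraic: "countable {x::'a::field_char_0. algebraic x}"
proof -
  let ?P = "\<lambda>l. Poly (map of_int l) :: 'a poly"
  have "{x::'a. algebraic x} \<subseteq> (\<Union>l\<in>{l. ?P l \<noteq> 0}. {x. poly (?P l) x = 0})"
  proof
    fix x :: 'a assume "x \<in> {x. algebraic x}"
    then obtain p where p: "\<And>i. coeff p i \<in> \<int>" "p \<noteq> 0" "poly p x = 0"
      by (auto simp: algebraic_def)
    have "set (coeffs p) \<subseteq> range of_int"
      using p(1) by (auto simp: coeffs_def Ints_def)
    then obtain l where "coeffs p = map of_int l"
      by (metis ex_map_conv image_iff subsetD)
    then have "?P l = p"
      by (metis Poly_coeffs)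
    with p show "x \<in> (\<Union>l\<in>{l. ?P l \<noteq> 0}. {x. poly (?P l) x = 0})"
      by blast
  qed
  moreover have "countable (\<Union>l\<in>{l. ?P l \<noteq> 0}. {x. poly (?P l) x = 0})"
    by (intro countable_UN) (auto intro: countable_finite poly_roots_finite)
  ultimately show ?thesis
    by (rule countable_subset)
qed

lemma transcendental_real_exists: "\<exists>s::real. \<not> algebraic s"
proof (rule ccontr)
  assume "\<not> ?thesis"
  then have "{x::real. algebraic x} = UNIV" by auto
  with countable_algebraic[where 'a=real] uncountable_UNIV_real show False by simp
qed

text \<open>
  If \<open>1 / s\<close> were \<open>p s\<close> for a rational polynomial \<open>p\<close>, then \<open>s\<close> would be a root of \<open>X * p - 1\<close>,
  which is not the zero polynomial because of its constant term.
\<close>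

lemma nonunit_subring_adjoin_transcendental:
  assumes "\<not> algebraic s"
  shows "nonunit_subring s (adjoin \<rat> s)"
proof -
  have Q: "rat_subring (\<rat> :: 'a set)"
    unfolding rat_subring_def by (blast intro: Rats_add Rats_mult)
  have "1 / s \<notin> power_span \<rat> s n" for n
  proof
    assume "1 / s \<in> power_span \<rat> s n"
    then obtain a where a: "\<And>i. a i \<in> \<rat>" "1 / s = (\<Sum>i<n. a i * s ^ i)"
      using power_spanE by metis
    let ?p = "pCons (- 1) (\<Sum>i<n. monom (a i) i)"
    have "s \<noteq> 0"
      using assms algebraic_0 by metis
    then have "poly ?p s = 0"
      by (simp add: poly_sum poly_monom a(2)[symmetric])
    moreover have "coeff ?p i \<in> \<rat>" for i
      by (cases i) (simp_all add: coeff_sum a(1))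
    moreover have "?p \<noteq> 0"
      by simp
    ultimately show False
      using assms algebraicI' by blast
  qed
  then have "1 / s \<notin> adjoin \<rat> s"
    unfolding adjoin_def by blast
  then show ?thesis
    using adjoin_superset(2)[OF Q] rat_subring_adjoin[OF Q]
    unfolding nonunit_subring_def by blast
qed

section \<open>The additive function\<close>

lemma rat_vector_space: "vector_space (\<lambda>q x. of_rat q * x :: 'a::field_char_0)"
  by unfold_locales (auto simp: algebra_simps of_rat_add of_rat_mult)

text \<open>
  Only the structure of \<open>A\<close> as a \<open>\<rat>\<close>-subspace matters: a basis of \<open>A\<close> stays independent when \<open>w\<close>
  is added to it, and so a linear map can be prescribed to be 1 at \<open>w\<close> and 0 on the basis.
\<close>

lemma additive_vanishing_on_rat_subring:
  fixes A :: "'a::field_char_0 set"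
  assumes A: "rat_subring A" and w: "w \<notin> A"
  obtains h :: "'a \<Rightarrow> 'a" where "additive h" "h w \<noteq> 0" "\<And>x. x \<in> A \<Longrightarrow> h x = 0"
proof -
  let ?s = "\<lambda>q x. of_rat q * x :: 'a"
  interpret V: vector_space ?s by (rule rat_vector_space)
  interpret VV: vector_space_pair ?s ?s ..
  have "V.subspace A"
    unfolding V.subspace_def
    by (blast intro: rat_subring_0[OF A] rat_subring_add[OF A] rat_subring_mult[OF A]
        rat_subring_Rats[OF A] Rats_of_rat)
  obtain B where B: "B \<subseteq> A" "V.independent B" "A \<subseteq> V.span B"
    by (rule V.maximal_independent_subset)
  then have span: "V.span B = A"
    using V.span_subspace \<open>V.subspace A\<close> by blast
  then have "V.independent (insert w B)"
    using w B by (intro V.independent_insertI) auto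
  then obtain h where h: "Vector_Spaces.linear ?s ?s h"
    "\<forall>x\<in>insert w B. h x = (if x = w then 1 else 0)"
    using VV.linear_independent_extend[of _ "\<lambda>x. if x = w then 1 else 0"] by blast
  have "w \<notin> B" using w B by blast
  show ?thesis
  proof
    show "additive h"
      using VV.linear_add[OF h(1)] by (simp add: additive_def)
    show "h w \<noteq> 0" using h(2) by simp
    show "h x = 0" if "x \<in> A" for x
    proof (rule VV.linear_eq_0_on_span[OF h(1)])
      show "h b = 0" if "b \<in> B" for b
        using h(2) that \<open>w \<notin> B\<close> by auto
      show "x \<in> V.span B"
        using that span by simp
    qed
  qed
qed

lemma real_eval_mem_rat_subring:
  assumes "rat_subring A" "t \<in> A"
  shows "real_eval p t \<in> A"
  unfolding real_eval_def
  by (induction p)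
    (auto simp: map_poly_pCons rat_subring_0[OF assms(1)]
      intro!: rat_subring_add[OF assms(1)] rat_subring_mult[OF assms(1)]
        rat_subring_Rats[OF assms(1) Rats_of_rat] assms(2))

theorem proposition30:
  fixes f g :: "rat poly"
  shows "\<exists>h :: real \<Rightarrow> real. additive h \<and> (\<exists>x. h x \<noteq> 0) \<and>
           (\<forall>x y. (x, y) \<in> param_curve f g \<longrightarrow> h x * h y = 0)"
proof -
  obtain s :: real where "\<not> algebraic s"
    using transcendental_real_exists by blast
  then obtain A where max: "maximal_nonunit_subring s A"
    using nonunit_subring_adjoin_transcendental maximal_nonunit_subring_exists by blast
  then have A: "rat_subring A" "1 / s \<notin> A"
    by (auto simp: maximal_nonunit_subring_def nonunit_subring_def)
  then obtain h :: "real \<Rightarrow> real" where h: "additive h" "h (1 / s) \<noteq> 0" "\<And>x. x \<in> A \<Longrightarrow> h x = 0"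
    using additive_vanishing_on_rat_subring by blast
  have "h x * h y = 0" if "(x, y) \<in> param_curve f g" for x y
  proof -
    have "\<exists>t. x = real_eval f t \<and> y = real_eval g (1 / t) \<and> t \<noteq> 0"
      using that by (simp only: param_curve_def mem_Collect_eq prod.inject conj_assoc)
    then obtain t where t: "t \<noteq> 0" "x = real_eval f t" "y = real_eval g (1 / t)"
      by metis
    then have "x \<in> A \<or> y \<in> A"
      using maximal_nonunit_subring_valuation[OF max] real_eval_mem_rat_subring[OF A(1)] by metis
    with h(3) show ?thesis by auto
  qed
  with h(1,2) show ?thesis by blast
qed

end
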